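(* Let $\{f_n\}_{n\ge 1}$ be any sequence in $\mathrm{Hol}(\mathbb{D},\mathbb{D})$ and let $L_n=f_n\circ f_{n-1}\circ\dots\circ f_1$. Then there is a map $h\in\mathrm{Hol}(\mathbb{D},\mathbb{D})$, unique up to left composition by elements of $\mathrm{Aut}(\mathbb{D})$, such that $\omega\bigl(L_n(z),L_n(w)\bigr)\to\omega\bigl(h(z),h(w)\bigr)$ as $n\to\infty$, for all $z,w\in\mathbb{D}$.
   Context: $\mathbb{D}$ is the open unit disc with hyperbolic distance $\omega$; $\mathrm{Hol}(\mathbb{D},\mathbb{D})$ is the set of holomorphic self-maps of $\mathbb{D}$ (constants included) and $\mathrm{Aut}(\mathbb{D})$ the group of conformal automorphisms of $\mathbb{D}$. "Unique up to left composition by elements of $\mathrm{Aut}(\mathbb{D})$" means that any two maps $h,k$ with the stated property satisfy $k=\phi\circ h$ for some $\phi\in\mathrm{Aut}(\mathbb{D})$. *)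

theory Defs
  imports "HOL-Complex_Analysis.Complex_Analysis"
begin

abbreviation unit_disc :: "complex set" where
  "unit_disc \<equiv> ball 0 1"

(* Elements are total functions on the complex plane; only their values on the disc matter, so
   equality of two such maps is to be read as equality on the disc. *)
definition Hol_disc :: "(complex \<Rightarrow> complex) set" where
  "Hol_disc = {f. f holomorphic_on unit_disc \<and> f ` unit_disc \<subseteq> unit_disc}"

definition Aut_disc :: "(complex \<Rightarrow> complex) set" where
  "Aut_disc = {\<phi> \<in> Hol_disc. \<exists>\<psi> \<in> Hol_disc. \<forall>z \<in> unit_disc. \<psi> (\<phi> z) = z \<and> \<phi> (\<psi> z) = z}"

(* The distance of the metric |dz| / (1 - |z|^2), of curvature -4, that is
   1/2 log ((1 + r) / (1 - r)) with r the pseudo-hyperbolic distance of z and w.  The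
   normalisation 2 |dz| / (1 - |z|^2) would double it.  Meaningful for z, w in the disc only. *)
definition hyp_dist :: "complex \<Rightarrow> complex \<Rightarrow> real" where
  "hyp_dist z w = artanh (cmod ((z - w) / (1 - cnj w * z)))"

(* left_comp f n is the composition of f n, ..., f 1, with f 1 applied first; f 0 is never used. *)
primrec left_comp :: "(nat \<Rightarrow> complex \<Rightarrow> complex) \<Rightarrow> nat \<Rightarrow> complex \<Rightarrow> complex" where
  "left_comp f 0 = id"
| "left_comp f (Suc n) = f (Suc n) \<circ> left_comp f n"

definition hyp_limit_map ::
    "(nat \<Rightarrow> complex \<Rightarrow> complex) \<Rightarrow> (complex \<Rightarrow> complex) \<Rightarrow> bool" where
  "hyp_limit_map L h \<longleftrightarrow> h \<in> Hol_disc \<and>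
     (\<forall>z \<in> unit_disc. \<forall>w \<in> unit_disc.
        (\<lambda>n. hyp_dist (L n z) (L n w)) \<longlonglongrightarrow> hyp_dist (h z) (h w))"

end

theory Submission
  imports Defs
begin

text \<open>
  Write \<open>p\<close> for the pseudo-hyperbolic distance, so that \<open>hyp_dist\<close> is \<open>artanh p\<close>, and \<open>M a\<close> for the
  automorphism \<open>z \<mapsto> (z - a) / (1 - cnj a z)\<close> of the disc (\<open>Moebius_function 0 a\<close>).  Since \<open>artanh\<close>
  is continuous and injective on \<open>[0, 1)\<close>, it is enough to deal with \<open>p\<close>, and
  \<open>p z w = norm (M w z)\<close>.

  Existence.  The maps \<open>L n\<close> themselves may escape to the boundary, but the distances do not see
  a left composition with an automorphism.  So \<open>L n\<close> may be replaced by
  \<open>g n = M (L n 0) \<circ> L n\<close>, which fixes \<open>0\<close>.  Montel's theorem gives a locally uniform limit \<open>h\<close> of a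
  subsequence of \<open>g\<close>, and the bound \<open>norm (g n z) \<le> norm z\<close> of Schwarz's lemma keeps the values of
  \<open>h\<close> in the open disc.  Along the subsequence the distances converge to those of \<open>h\<close>; by
  Schwarz--Pick they decrease with \<open>n\<close>, so the whole sequence converges to the same limit.

  Uniqueness.  Two limit maps induce the same distances, and after composition with automorphisms
  both fix \<open>0\<close>.  Call the normalised maps \<open>H\<close> and \<open>K\<close>.  The distances to \<open>0\<close> give
  \<open>norm (H z) = norm (K z)\<close>, and then the other distances give the equality of the real parts of
  \<open>cnj (H w) * H z\<close> and \<open>cnj (K w) * K z\<close>.  For a fixed \<open>w\<close> these are holomorphic in \<open>z\<close> and vanish at
  \<open>0\<close>, so they are equal; this makes \<open>K\<close> a rotation of \<open>H\<close>.
\<close>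

section \<open>Automorphisms of the disc\<close>

lemma Hol_discD:
  assumes "f \<in> Hol_disc"
  shows "f holomorphic_on unit_disc" "\<And>z. z \<in> unit_disc \<Longrightarrow> f z \<in> unit_disc"
  using assms unfolding Hol_disc_def by blast+

lemma Hol_disc_comp:
  assumes "f \<in> Hol_disc" "g \<in> Hol_disc"
  shows "f \<circ> g \<in> Hol_disc"
proof -
  have "f \<circ> g holomorphic_on unit_disc"
    using assms by (auto simp: Hol_disc_def intro: holomorphic_on_compose holomorphic_on_subset)
  then show ?thesis
    using assms by (auto simp: Hol_disc_def)
qed

lemma Aut_disc_imp_Hol_disc: "\<phi> \<in> Aut_disc \<Longrightarrow> \<phi> \<in> Hol_disc"
  by (simp add: Aut_disc_def)

lemma Aut_discI:
  assumes "\<phi> \<in> Hol_disc" "\<psi> \<in> Hol_disc"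
    and "\<And>z. z \<in> unit_disc \<Longrightarrow> \<psi> (\<phi> z) = z" "\<And>z. z \<in> unit_disc \<Longrightarrow> \<phi> (\<psi> z) = z"
  shows "\<phi> \<in> Aut_disc"
  using assms unfolding Aut_disc_def by blast

lemma Aut_disc_comp:
  assumes "\<phi> \<in> Aut_disc" "\<psi> \<in> Aut_disc"
  shows "\<phi> \<circ> \<psi> \<in> Aut_disc"
proof -
  obtain \<phi>' where \<phi>: "\<phi> \<in> Hol_disc" "\<phi>' \<in> Hol_disc"
      "\<forall>z \<in> unit_disc. \<phi>' (\<phi> z) = z \<and> \<phi> (\<phi>' z) = z"
    using assms(1) by (auto simp: Aut_disc_def)
  obtain \<psi>' where \<psi>: "\<psi> \<in> Hol_disc" "\<psi>' \<in> Hol_disc"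
      "\<forall>z \<in> unit_disc. \<psi>' (\<psi> z) = z \<and> \<psi> (\<psi>' z) = z"
    using assms(2) by (auto simp: Aut_disc_def)
  show ?thesis
  proof (rule Aut_discI[where \<psi> = "\<psi>' \<circ> \<phi>'"])
    show "(\<psi>' \<circ> \<phi>') ((\<phi> \<circ> \<psi>) z) = z" "(\<phi> \<circ> \<psi>) ((\<psi>' \<circ> \<phi>') z) = z"
      if "z \<in> unit_disc" for z
      using that \<phi> \<psi> Hol_discD(2)[OF \<psi>(1) that] Hol_discD(2)[OF \<phi>(2) that] by auto
  qed (use \<phi> \<psi> Hol_disc_comp in blast)+
qed

lemma Moebius_function_Hol_disc: "a \<in> unit_disc \<Longrightarrow> Moebius_function 0 a \<in> Hol_disc"
  using Moebius_function_holomorphic[of a 0] Moebius_function_norm_lt_1[of a _ 0]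
  by (auto simp: Hol_disc_def)

lemma Moebius_function_inverse:
  assumes "a \<in> unit_disc" "z \<in> unit_disc"
  shows "Moebius_function 0 (- a) (Moebius_function 0 a z) = z"
    and "Moebius_function 0 a (Moebius_function 0 (- a) z) = z"
  using assms by (auto intro: Moebius_function_compose)

lemma Moebius_function_Aut_disc: "a \<in> unit_disc \<Longrightarrow> Moebius_function 0 a \<in> Aut_disc"
  by (rule Aut_discI[where \<psi> = "Moebius_function 0 (- a)"])
    (auto simp: Moebius_function_Hol_disc Moebius_function_inverse)

lemma rotation_Aut_disc:
  assumes "cmod c = 1"
  shows "(*) c \<in> Aut_disc"
proof (rule Aut_discI[where \<psi> = "(*) (inverse c)"])
  have c: "c \<noteq> 0" using assms by auto
  show "inverse c * (c * z) = z" "c * (inverse c * z) = z" for z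
    using c by auto
  show "(*) c \<in> Hol_disc" "(*) (inverse c) \<in> Hol_disc"
    using assms by (auto simp: Hol_disc_def norm_mult norm_inverse intro!: holomorphic_intros)
qed


section \<open>The pseudo-hyperbolic distance\<close>

lemma hyp_dist_Moebius: "hyp_dist z w = artanh (cmod (Moebius_function 0 w z))"
  by (simp add: hyp_dist_def Moebius_function_simple)

lemma artanh_inj_on: "inj_on (artanh :: real \<Rightarrow> real) {0..<1}"
proof (rule inj_onI)
  fix x y :: real assume xy: "x \<in> {0..<1}" "y \<in> {0..<1}" "artanh x = artanh y"
  then have "(1 + x) / (1 - x) = (1 + y) / (1 - y)"
    by (auto simp: artanh_def)
  then have "(1 + x) * (1 - y) = (1 + y) * (1 - x)"
    using xy(1,2) by (simp add: frac_eq_eq)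
  then show "x = y"
    by (simp add: algebra_simps)
qed

lemma cmod_Moebius_eq_of_hyp_dist_eq:
  assumes "z \<in> unit_disc" "w \<in> unit_disc" "z' \<in> unit_disc" "w' \<in> unit_disc"
    and "hyp_dist z w = hyp_dist z' w'"
  shows "cmod (Moebius_function 0 w z) = cmod (Moebius_function 0 w' z')"
proof (rule inj_onD[OF artanh_inj_on])
  show "artanh (cmod (Moebius_function 0 w z)) = artanh (cmod (Moebius_function 0 w' z'))"
    using assms(5) by (simp add: hyp_dist_Moebius)
qed (use assms(1-4) Moebius_function_norm_lt_1 in auto)

lemma cmod_one_minus_cnj_mult:
  "(cmod (1 - cnj w * z))\<^sup>2 = (cmod (z - w))\<^sup>2 + (1 - (cmod z)\<^sup>2) * (1 - (cmod w)\<^sup>2)"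
  unfolding cmod_power2 by (simp add: power2_eq_square algebra_simps)

text \<open>Schwarz's lemma, transported from \<open>0\<close> to \<open>w\<close> by the two Moebius maps.\<close>

lemma Schwarz_Pick:
  assumes f: "f \<in> Hol_disc" and z: "z \<in> unit_disc" and w: "w \<in> unit_disc"
  shows "cmod (Moebius_function 0 (f w) (f z)) \<le> cmod (Moebius_function 0 w z)"
proof -
  define g where "g = Moebius_function 0 (f w) \<circ> f \<circ> Moebius_function 0 (- w)"
  have g: "g \<in> Hol_disc"
    unfolding g_def using w Hol_discD(2)[OF f w]
    by (intro Hol_disc_comp f Moebius_function_Hol_disc) auto
  have "g 0 = 0"
    by (simp add: g_def Moebius_function_of_zero Moebius_function_eq_zero)
  moreover have "Moebius_function 0 w z \<in> unit_disc"
    using Hol_discD(2)[OF Moebius_function_Hol_disc] z w by blast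
  ultimately have "cmod (g (Moebius_function 0 w z)) \<le> cmod (Moebius_function 0 w z)"
    using Hol_discD[OF g] by (intro Schwarz_Lemma(1)) auto
  then show ?thesis
    using Moebius_function_inverse[OF w z] by (simp add: g_def)
qed

lemma Aut_disc_isometry:
  assumes \<phi>: "\<phi> \<in> Aut_disc" and z: "z \<in> unit_disc" and w: "w \<in> unit_disc"
  shows "cmod (Moebius_function 0 (\<phi> w) (\<phi> z)) = cmod (Moebius_function 0 w z)"
proof (rule antisym)
  obtain \<psi> where \<psi>: "\<psi> \<in> Hol_disc" and inv: "\<forall>z \<in> unit_disc. \<psi> (\<phi> z) = z"
    using \<phi> by (auto simp: Aut_disc_def)
  have \<phi>': "\<phi> \<in> Hol_disc"
    using \<phi> by (rule Aut_disc_imp_Hol_disc)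
  show "cmod (Moebius_function 0 (\<phi> w) (\<phi> z)) \<le> cmod (Moebius_function 0 w z)"
    using \<phi>' z w by (rule Schwarz_Pick)
  show "cmod (Moebius_function 0 w z) \<le> cmod (Moebius_function 0 (\<phi> w) (\<phi> z))"
    using Schwarz_Pick[OF \<psi> Hol_discD(2)[OF \<phi>' z] Hol_discD(2)[OF \<phi>' w]] inv z w by simp
qed


section \<open>Existence of the limit map\<close>

text \<open>
  A limit point of the maps \<open>L n\<close> itself may be a constant on the unit circle.  Composing each with the
  automorphism that sends \<open>L n 0\<close> to \<open>0\<close> leaves the distances alone, and Schwarz's lemma then bounds
  the \<open>n\<close>-th map, and hence the limit, by \<open>norm z < 1\<close> at the point \<open>z\<close>.
\<close>

lemma exists_subsequence_limit:
  assumes L: "\<And>n::nat. L n \<in> Hol_disc"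
  obtains h r where "h \<in> Hol_disc" "strict_mono (r :: nat \<Rightarrow> nat)"
    "\<And>z w. \<lbrakk>z \<in> unit_disc; w \<in> unit_disc\<rbrakk> \<Longrightarrow>
       (\<lambda>n. cmod (Moebius_function 0 (L (r n) w) (L (r n) z)))
         \<longlonglongrightarrow> cmod (Moebius_function 0 (h w) (h z))"
proof -
  have L0: "L n 0 \<in> unit_disc" for n
    using Hol_discD(2)[OF L] by simp
  define g where "g n = Moebius_function 0 (L n 0) \<circ> L n" for n
  have g: "g n \<in> Hol_disc" for n
    unfolding g_def by (intro Hol_disc_comp Moebius_function_Hol_disc L L0)
  have g_le: "cmod (g n z) \<le> cmod z" if "z \<in> unit_disc" for n z
  proof (rule Schwarz_Lemma(1))
    show "g n 0 = 0" by (simp add: g_def Moebius_function_eq_zero)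
  qed (use that Hol_discD[OF g] in auto)
  obtain h r where h: "h holomorphic_on unit_disc" and r: "strict_mono (r :: nat \<Rightarrow> nat)"
    and lim: "\<And>z. z \<in> unit_disc \<Longrightarrow> (\<lambda>n. g (r n) z) \<longlonglongrightarrow> h z"
  proof (rule Montel[of unit_disc Hol_disc g])
    show "\<exists>B. \<forall>h\<in>Hol_disc. \<forall>z\<in>K. cmod (h z) \<le> B" if "K \<subseteq> unit_disc" for K
      using that by (intro exI[of _ 1]) (force simp: Hol_disc_def)
  qed (use g in \<open>auto simp: Hol_discD\<close>)
  have "cmod (h z) \<le> cmod z" if "z \<in> unit_disc" for z
    using g_le[OF that] by (intro Lim_norm_ubound[OF _ lim[OF that]]) auto
  then have h': "h \<in> Hol_disc"
    using h by (force simp: Hol_disc_def)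
  show ?thesis
  proof (rule that[OF h' r])
    fix z w assume zw: "z \<in> unit_disc" "w \<in> unit_disc"
    have "cmod (cnj (h w) * h z) < 1"
      using Hol_discD(2)[OF h'] zw norm_mult_less[of "cnj (h w)" 1 "h z" 1] by simp
    then have nz: "1 - cnj (h w) * h z \<noteq> 0"
      by auto
    have "(\<lambda>n. cmod (Moebius_function 0 (g (r n) w) (g (r n) z)))
            \<longlonglongrightarrow> cmod (Moebius_function 0 (h w) (h z))"
      unfolding Moebius_function_simple by (intro tendsto_intros lim zw nz)
    moreover have "cmod (Moebius_function 0 (g n w) (g n z))
        = cmod (Moebius_function 0 (L n w) (L n z))" for n
      using Aut_disc_isometry[OF Moebius_function_Aut_disc[OF L0]] Hol_discD(2)[OF L] zw
      by (simp add: g_def)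
    ultimately show "(\<lambda>n. cmod (Moebius_function 0 (L (r n) w) (L (r n) z)))
            \<longlonglongrightarrow> cmod (Moebius_function 0 (h w) (h z))"
      by simp
  qed
qed

lemma left_comp_Hol_disc:
  assumes "\<And>n. n \<ge> 1 \<Longrightarrow> f n \<in> Hol_disc"
  shows "left_comp f n \<in> Hol_disc"
proof (induction n)
  case 0
  show ?case by (auto simp: Hol_disc_def)
next
  case (Suc n)
  then show ?case using assms[of "Suc n"] by (simp add: Hol_disc_comp del: comp_apply)
qed

text \<open>
  The distances \<open>p (L n z) (L n w)\<close> decrease because \<open>L (n + 1)\<close> is \<open>f (n + 1)\<close> after \<open>L n\<close>: this is
  where the order of composition matters, and it turns the limit along a subsequence into a limit.
\<close>

lemma hyp_limit_map_exists:
  assumes f: "\<And>n. n \<ge> 1 \<Longrightarrow> f n \<in> Hol_disc"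
  shows "\<exists>h. hyp_limit_map (left_comp f) h"
proof -
  define L where "L = left_comp f"
  have L: "L n \<in> Hol_disc" for n
    unfolding L_def using f by (rule left_comp_Hol_disc)
  obtain h r where h: "h \<in> Hol_disc" and r: "strict_mono (r :: nat \<Rightarrow> nat)"
    and lim: "\<And>z w. \<lbrakk>z \<in> unit_disc; w \<in> unit_disc\<rbrakk> \<Longrightarrow>
       (\<lambda>n. cmod (Moebius_function 0 (L (r n) w) (L (r n) z)))
         \<longlonglongrightarrow> cmod (Moebius_function 0 (h w) (h z))"
    by (rule exists_subsequence_limit[of L, OF L]) blast
  have "(\<lambda>n. hyp_dist (L n z) (L n w)) \<longlonglongrightarrow> hyp_dist (h z) (h w)"
    if zw: "z \<in> unit_disc" "w \<in> unit_disc" for z w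
  proof -
    define p where "p n = cmod (Moebius_function 0 (L n w) (L n z))" for n
    have "p (Suc n) \<le> p n" for n
      using Schwarz_Pick[OF f Hol_discD(2)[OF L] Hol_discD(2)[OF L]] zw
      by (simp add: p_def L_def)
    then have "decseq p"
      by (rule decseq_SucI)
    then obtain l where l: "p \<longlonglongrightarrow> l"
      using decseq_convergent[of p 0] by (auto simp: p_def)
    have "(\<lambda>n. p (r n)) \<longlonglongrightarrow> l"
      using LIMSEQ_subseq_LIMSEQ[OF l r] by (simp add: o_def)
    then have "l = cmod (Moebius_function 0 (h w) (h z))"
      using lim[OF zw] unfolding p_def by (rule LIMSEQ_unique)
    moreover from this have "0 \<le> l" "l < 1"
      using Moebius_function_norm_lt_1 Hol_discD(2)[OF h] zw by simp_all
    then have "(\<lambda>n. artanh (p n)) \<longlonglongrightarrow> artanh l"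
      by (intro tendsto_artanh[OF l]) linarith+
    ultimately show ?thesis
      by (simp add: hyp_dist_Moebius p_def)
  qed
  then show ?thesis
    using h unfolding hyp_limit_map_def L_def by blast
qed


section \<open>Uniqueness of the limit map\<close>

text \<open>
  The image lies in the imaginary axis, which has empty interior; the open mapping theorem forbids
  this for a non-constant map.
\<close>

lemma holomorphic_Re_zero_imp_constant_on:
  assumes "f holomorphic_on S" "open S" "connected S" "\<And>z. z \<in> S \<Longrightarrow> Re (f z) = 0"
  shows "f constant_on S"
proof (rule ccontr)
  assume nc: "\<not> f constant_on S"
  then obtain z where z: "z \<in> S"
    by (auto simp: constant_on_def)
  have "open (f ` S)"
    using open_mapping_thm[OF assms(1-3) assms(2) order_refl nc] .
  then obtain e where e: "e > 0" "cball (f z) e \<subseteq> f ` S"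
    using z open_contains_cball by blast
  then have "f z + of_real e \<in> f ` S"
    by (intro subsetD[OF e(2)]) (auto simp: dist_norm)
  then obtain y where "y \<in> S" "f y = f z + of_real e"
    by force
  then show False
    using assms(4)[of y] assms(4)[OF z] e by simp
qed

text \<open>
  With the moduli of \<open>z\<close> and \<open>w\<close> fixed, the pseudo-hyperbolic distance is a strictly increasing
  function of the Euclidean distance \<open>norm (z - w)\<close>, and polarisation recovers the real inner
  product from the Euclidean distance and the moduli.
\<close>

lemma Re_cnj_mult_eq_of_cmod_Moebius_eq:
  assumes disc: "z \<in> unit_disc" "w \<in> unit_disc"
    and norms: "cmod z' = cmod z" "cmod w' = cmod w"
    and eq: "cmod (Moebius_function 0 w' z') = cmod (Moebius_function 0 w z)"
  shows "Re (cnj w' * z') = Re (cnj w * z)"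
proof -
  define P where "P = (1 - (cmod z)\<^sup>2) * (1 - (cmod w)\<^sup>2)"
  have P: "P > 0"
    using disc unfolding P_def by (auto simp: power_less_one_iff abs_square_less_1)
  have p: "(cmod (Moebius_function 0 w z))\<^sup>2 = (cmod (z - w))\<^sup>2 / ((cmod (z - w))\<^sup>2 + P)"
    by (simp add: Moebius_function_simple norm_divide power_divide cmod_one_minus_cnj_mult P_def)
  have p': "(cmod (Moebius_function 0 w' z'))\<^sup>2 = (cmod (z' - w'))\<^sup>2 / ((cmod (z' - w'))\<^sup>2 + P)"
    by (simp add: Moebius_function_simple norm_divide power_divide cmod_one_minus_cnj_mult P_def
        norms)
  have pos: "(cmod (z - w))\<^sup>2 + P > 0" "(cmod (z' - w'))\<^sup>2 + P > 0"
    using P by (auto intro: add_nonneg_pos)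
  have "(cmod (z' - w'))\<^sup>2 / ((cmod (z' - w'))\<^sup>2 + P) = (cmod (z - w))\<^sup>2 / ((cmod (z - w))\<^sup>2 + P)"
    using p p' eq by simp
  then have "(cmod (z' - w'))\<^sup>2 = (cmod (z - w))\<^sup>2"
    using pos P by (simp add: frac_eq_eq algebra_simps)
  moreover
  \<comment> \<open>polarisation identity of the real inner product \<open>Re (cnj b * a)\<close>\<close>
  have "2 * Re (cnj b * a) = (cmod a)\<^sup>2 + (cmod b)\<^sup>2 - (cmod (a - b))\<^sup>2" for a b
    unfolding cmod_power2 by (simp add: power2_eq_square algebra_simps)
  from this[of w z] this[of w' z'] calculation norms show ?thesis
    by simp
qed

text \<open>
  Equality of the distances alone would also allow \<open>K = cnj \<circ> H\<close>; holomorphy of both maps excludes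
  this, through the passage from the real part of \<open>cnj (H w) * H z\<close> to its value.
\<close>

lemma rotation_of_equal_distances:
  assumes H: "H \<in> Hol_disc" "H 0 = 0" and K: "K \<in> Hol_disc" "K 0 = 0"
    and eq: "\<And>z w. \<lbrakk>z \<in> unit_disc; w \<in> unit_disc\<rbrakk> \<Longrightarrow>
       cmod (Moebius_function 0 (K w) (K z)) = cmod (Moebius_function 0 (H w) (H z))"
  obtains c where "cmod c = 1" "\<And>z. z \<in> unit_disc \<Longrightarrow> K z = c * H z"
proof -
  have norms: "cmod (K z) = cmod (H z)" if "z \<in> unit_disc" for z
    using eq[of z 0] that H K by (simp add: Moebius_function_simple)
  show ?thesis
  proof (cases "\<forall>z \<in> unit_disc. H z = 0")
    case True
    then have "K z = 1 * H z" if "z \<in> unit_disc" for z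
      using norms[OF that] that by auto
    then show ?thesis
      using that[of 1] by auto
  next
    case False
    then obtain w where w: "w \<in> unit_disc" "H w \<noteq> 0"
      by blast
    then have Kw: "K w \<noteq> 0"
      using norms by fastforce
    define d where "d z = cnj (K w) * K z - cnj (H w) * H z" for z
    have "Re (d z) = 0" if z: "z \<in> unit_disc" for z
      using Re_cnj_mult_eq_of_cmod_Moebius_eq[of "H z" "H w" "K z" "K w"]
        norms eq z w Hol_discD(2)[OF H(1)] by (simp add: d_def)
    moreover have "d holomorphic_on unit_disc"
      unfolding d_def by (intro holomorphic_intros Hol_discD(1) H K)
    ultimately have "d constant_on unit_disc"
      by (intro holomorphic_Re_zero_imp_constant_on) auto
    moreover have "d 0 = 0"
      by (simp add: d_def H K)
    ultimately have d: "d z = 0" if "z \<in> unit_disc" for z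
      using that unfolding constant_on_def by (metis centre_in_ball zero_less_one)
    show ?thesis
    proof (rule that)
      show "cmod (cnj (H w) / cnj (K w)) = 1"
        using norms[OF w(1)] w(2) by (simp add: norm_divide)
      show "K z = cnj (H w) / cnj (K w) * H z" if "z \<in> unit_disc" for z
        using d[OF that] Kw by (simp add: d_def field_simps)
    qed
  qed
qed

lemma Aut_disc_of_equal_distances:
  assumes h: "h \<in> Hol_disc" and k: "k \<in> Hol_disc"
    and eq: "\<And>z w. \<lbrakk>z \<in> unit_disc; w \<in> unit_disc\<rbrakk> \<Longrightarrow>
       cmod (Moebius_function 0 (k w) (k z)) = cmod (Moebius_function 0 (h w) (h z))"
  shows "\<exists>\<phi> \<in> Aut_disc. \<forall>z \<in> unit_disc. k z = (\<phi> \<circ> h) z"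
proof -
  have h0: "h 0 \<in> unit_disc" and k0: "k 0 \<in> unit_disc" and k0': "- k 0 \<in> unit_disc"
    using Hol_discD(2)[OF h, of 0] Hol_discD(2)[OF k, of 0] by auto
  define H where "H = Moebius_function 0 (h 0) \<circ> h"
  define K where "K = Moebius_function 0 (k 0) \<circ> k"
  obtain c where c: "cmod c = 1" "\<And>z. z \<in> unit_disc \<Longrightarrow> K z = c * H z"
  proof (rule rotation_of_equal_distances[of H K])
    show "H \<in> Hol_disc" "K \<in> Hol_disc"
      unfolding H_def K_def by (intro Hol_disc_comp Moebius_function_Hol_disc h k h0 k0)+
    show "H 0 = 0" "K 0 = 0"
      by (simp_all add: H_def K_def Moebius_function_eq_zero)
    show "cmod (Moebius_function 0 (K w) (K z)) = cmod (Moebius_function 0 (H w) (H z))"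
      if "z \<in> unit_disc" "w \<in> unit_disc" for z w
      using that eq Hol_discD(2)[OF h] Hol_discD(2)[OF k]
        Aut_disc_isometry[OF Moebius_function_Aut_disc[OF h0]]
        Aut_disc_isometry[OF Moebius_function_Aut_disc[OF k0]]
      by (simp add: H_def K_def)
  qed blast
  define \<phi> where "\<phi> = Moebius_function 0 (- k 0) \<circ> (*) c \<circ> Moebius_function 0 (h 0)"
  have "\<phi> \<in> Aut_disc"
    unfolding \<phi>_def
    by (intro Aut_disc_comp Moebius_function_Aut_disc rotation_Aut_disc c(1) h0 k0')
  moreover have "k z = (\<phi> \<circ> h) z" if z: "z \<in> unit_disc" for z
    using c(2)[OF z] Moebius_function_inverse(1)[OF k0 Hol_discD(2)[OF k z]]
    by (simp add: \<phi>_def H_def K_def)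
  ultimately show ?thesis
    by blast
qed

lemma hyp_limit_map_unique:
  assumes h: "hyp_limit_map L h" and k: "hyp_limit_map L k"
  shows "\<exists>\<phi> \<in> Aut_disc. \<forall>z \<in> unit_disc. k z = (\<phi> \<circ> h) z"
proof -
  have hk: "h \<in> Hol_disc" "k \<in> Hol_disc"
    using h k by (auto simp: hyp_limit_map_def)
  show ?thesis
  proof (rule Aut_disc_of_equal_distances[OF hk])
    fix z w assume zw: "z \<in> unit_disc" "w \<in> unit_disc"
    have "hyp_dist (k z) (k w) = hyp_dist (h z) (h w)"
      using h k zw LIMSEQ_unique unfolding hyp_limit_map_def by blast
    with zw show "cmod (Moebius_function 0 (k w) (k z)) = cmod (Moebius_function 0 (h w) (h z))"
      using Hol_discD(2)[OF hk(1)] Hol_discD(2)[OF hk(2)]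
      by (intro cmod_Moebius_eq_of_hyp_dist_eq)
  qed
qed


section \<open>Left compositions of self-maps of the disc\<close>

theorem corollaryC:
  fixes f :: "nat \<Rightarrow> complex \<Rightarrow> complex"
  assumes "\<And>n. n \<ge> 1 \<Longrightarrow> f n \<in> Hol_disc"
  shows "(\<exists>h. hyp_limit_map (left_comp f) h) \<and>
         (\<forall>h k. hyp_limit_map (left_comp f) h \<longrightarrow> hyp_limit_map (left_comp f) k \<longrightarrow>
            (\<exists>\<phi> \<in> Aut_disc. \<forall>z \<in> unit_disc. k z = (\<phi> \<circ> h) z))"
  using hyp_limit_map_exists[of f] assms hyp_limit_map_unique by blast

end
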